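(* Let $(R,\mathfrak{m})$ be a local ring with maximal ideal $\mathfrak{m}$ and let $I$ be a proper ideal in $R$. Then the Excision ring $R\oplus I$ is also a local ring, with maximal ideal $\mathfrak{m}\oplus I$.
   Context: All rings are commutative with unity. The Excision ring $R\oplus I$ of a ring $R$ with respect to an ideal $I$ has coordinatewise addition and multiplication $(r,i)(s,j)=(rs,rj+si+ij)$, with identity $(1,0)$. *)

theory Defs
  imports "HOL-Algebra.QuotRing"
begin

(* No Noetherian hypothesis. The zero ring is excluded, as it has no maximal ideal. *)
definition local_ring :: "('a, 'b) ring_scheme \<Rightarrow> bool" where
  "local_ring R \<longleftrightarrow> cring R \<and> (\<exists>!M. maximalideal M R)"

definition excision_ring :: "('a, 'b) ring_scheme \<Rightarrow> 'a set \<Rightarrow> ('a \<times> 'a) ring" where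
  "excision_ring R I =
    \<lparr>carrier = carrier R \<times> I,
     monoid.mult = (\<lambda>(r, i) (s, j).
       (r \<otimes>\<^bsub>R\<^esub> s, r \<otimes>\<^bsub>R\<^esub> j \<oplus>\<^bsub>R\<^esub> s \<otimes>\<^bsub>R\<^esub> i \<oplus>\<^bsub>R\<^esub> i \<otimes>\<^bsub>R\<^esub> j)),
     monoid.one = (\<one>\<^bsub>R\<^esub>, \<zero>\<^bsub>R\<^esub>),
     ring.zero = (\<zero>\<^bsub>R\<^esub>, \<zero>\<^bsub>R\<^esub>),
     ring.add = (\<lambda>(r, i) (s, j). (r \<oplus>\<^bsub>R\<^esub> s, i \<oplus>\<^bsub>R\<^esub> j))\<rparr>"

end

theory Submission
  imports Defs "HOL-Algebra.Ring_Divisibility"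
begin

text \<open>
  Everything rests on one description of local rings: a commutative ring is local with maximal
  ideal \<open>M\<close> as soon as \<open>M\<close> is a proper ideal and every element outside \<open>M\<close> is a unit
  (\<open>local_of_units_outside\<close>), and conversely, by Krull's theorem, the elements outside the maximal
  ideal of a local ring are units (\<open>unit_outside_local\<close>).

  The set \<open>m \<times> I\<close> is an ideal because it is the preimage of \<open>m\<close> under the projection
  \<open>(r, i) \<mapsto> r\<close>, which is a ring homomorphism (\<open>excision_fst_hom\<close>). For the units, note that
  \<open>(r, i) \<mapsto> r + i\<close> is a homomorphism too, and that both maps together embed the excision ring into \<open>R \<times> R\<close> as the pairs
  whose coordinates agree modulo \<open>I\<close>. Hence \<open>(r, i)\<close> is a unit as soon as \<open>r\<close> and \<open>r + i\<close> are: the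
  inverses of two elements that are congruent modulo \<open>I\<close> are congruent modulo \<open>I\<close>
  (\<open>excision_unit\<close>). Now \<open>I\<close> is proper and therefore lies in \<open>m\<close> (\<open>proper_ideal_le_local\<close>), so
  that \<open>r \<notin> m\<close> forces \<open>r + i \<notin> m\<close>, and both are units.
\<close>

text \<open>
  Krull's theorem, by Zorn's lemma on the ideals above \<open>J\<close> that avoid \<open>\<one>\<close>: unlike properness,
  avoiding \<open>\<one>\<close> is visibly inherited by unions of chains.
\<close>

lemma (in ring) proper_ideal_in_maximalideal:
  assumes "ideal J R" "J \<noteq> carrier R"
  obtains M where "maximalideal M R" "J \<subseteq> M"
proof -
  define A where "A = {K. ideal K R \<and> J \<subseteq> K \<and> \<one> \<notin> K}"
  have J: "J \<in> A"
    using assms ideal.one_imp_carrier unfolding A_def by blast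
  have "\<exists>U\<in>A. \<forall>X\<in>C. X \<subseteq> U" if C: "subset.chain A C" for C
  proof (cases "C = {}")
    case True
    with J show ?thesis by auto
  next
    case False
    have "subset.chain {K. ideal K R} C"
      using C unfolding subset_chain_def A_def by blast
    with False have "ideal (\<Union>C) R"
      using chain_Union_is_ideal[of C] by simp
    with C False have "\<Union>C \<in> A"
      unfolding subset_chain_def A_def by blast
    then show ?thesis by blast
  qed
  then obtain M where M: "M \<in> A" and max: "\<forall>X\<in>A. M \<subseteq> X \<longrightarrow> X = M"
    using subset_Zorn[of A] by blast
  have "maximalideal M R"
  proof (rule maximalidealI)
    show "ideal M R" "carrier R \<noteq> M"
      using M unfolding A_def by auto
    show "K = M \<or> K = carrier R" if "ideal K R" "M \<subseteq> K" for K
      using that M max ideal.one_imp_carrier[OF that(1)] unfolding A_def by blast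
  qed
  moreover have "J \<subseteq> M" using M unfolding A_def by blast
  ultimately show thesis by (rule that)
qed

lemma proper_ideal_le_local:
  assumes "local_ring R" "maximalideal m R" "ideal J R" "J \<noteq> carrier R"
  shows "J \<subseteq> m"
proof -
  interpret cring R using assms(1) by (simp add: local_ring_def)
  obtain M where "maximalideal M R" "J \<subseteq> M"
    using assms(3,4) by (rule proper_ideal_in_maximalideal)
  moreover from this have "M = m"
    using assms(1,2) unfolding local_ring_def by blast
  ultimately show ?thesis by simp
qed

text \<open>
  The principal ideal of such an \<open>x\<close> is not contained in \<open>m\<close>, so it cannot be proper.
\<close>

lemma unit_outside_local:
  assumes "local_ring R" "maximalideal m R" "x \<in> carrier R" "x \<notin> m"
  shows "x \<in> Units R"
proof -
  interpret cring R using assms(1) by (simp add: local_ring_def)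
  have "PIdl\<^bsub>R\<^esub> x = carrier R"
    using proper_ideal_le_local[OF assms(1,2) cgenideal_ideal[OF assms(3)]]
      cgenideal_self[OF assms(3)] assms(4) by blast
  then have "\<one>\<^bsub>R\<^esub> \<in> PIdl\<^bsub>R\<^esub> x"
    by simp
  then obtain y where y: "y \<in> carrier R" "y \<otimes>\<^bsub>R\<^esub> x = \<one>\<^bsub>R\<^esub>"
    unfolding cgenideal_def by auto
  moreover have "x \<otimes>\<^bsub>R\<^esub> y = \<one>\<^bsub>R\<^esub>"
    using y assms(3) by (simp add: m_comm)
  ultimately show ?thesis
    using assms(3) unfolding Units_def by blast
qed

lemma (in ideal) unit_imp_carrier:
  assumes "x \<in> I" "x \<in> Units R"
  shows "I = carrier R"
proof -
  have "inv x \<otimes> x \<in> I"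
    using assms by (intro I_l_closed) auto
  with assms(2) show ?thesis
    by (simp add: one_imp_carrier)
qed

text \<open>
  A proper ideal contains no unit, so all proper ideals lie in \<open>M\<close>: this gives the maximality of
  \<open>M\<close> and its uniqueness at once.
\<close>

lemma local_of_units_outside:
  assumes "cring S" "ideal M S" "M \<noteq> carrier S"
    and units: "\<And>x. x \<in> carrier S \<Longrightarrow> x \<notin> M \<Longrightarrow> x \<in> Units S"
  shows "local_ring S \<and> maximalideal M S"
proof -
  have below: "K \<subseteq> M" if K: "ideal K S" "K \<noteq> carrier S" for K
    using that units ideal.unit_imp_carrier[OF K(1)] ideal.Icarr[OF K(1)] by blast
  have max: "maximalideal M S"
    using assms(2,3) below by (intro maximalidealI) auto
  have "K = M" if K: "maximalideal K S" for K
  proof -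
    have "ideal K S" "K \<noteq> carrier S"
      using maximalideal.axioms(1)[OF K] maximalideal.I_notcarr[OF K] by auto
    then show ?thesis
      using below maximalideal.I_maximal[OF K assms(2)] assms(3)
        additive_subgroup.a_subset[OF ideal.axioms(1)[OF assms(2)]] by blast
  qed
  with max assms(1) show ?thesis
    unfolding local_ring_def by blast
qed

context ideal
begin

lemma excision_carrier: "carrier (excision_ring R I) = carrier R \<times> I"
  and excision_mult: "(r, i) \<otimes>\<^bsub>excision_ring R I\<^esub> (s, j) = (r \<otimes> s, r \<otimes> j \<oplus> s \<otimes> i \<oplus> i \<otimes> j)"
  and excision_one: "\<one>\<^bsub>excision_ring R I\<^esub> = (\<one>, \<zero>)"
  and excision_zero: "\<zero>\<^bsub>excision_ring R I\<^esub> = (\<zero>, \<zero>)"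
  and excision_add: "(r, i) \<oplus>\<^bsub>excision_ring R I\<^esub> (s, j) = (r \<oplus> s, i \<oplus> j)"
  by (simp_all add: excision_ring_def)

lemmas excision_simps = excision_carrier excision_mult excision_one excision_zero excision_add

lemma excision_cring:
  assumes "cring R"
  shows "cring (excision_ring R I)"
proof (rule cringI)
  interpret cring R by fact
  have neg: "\<ominus> i \<in> I" if "i \<in> I" for i
    using that by simp
  show "abelian_group (excision_ring R I)"
  proof (rule abelian_groupI)
    fix x assume "x \<in> carrier (excision_ring R I)"
    then obtain r i where x: "x = (r, i)" "r \<in> carrier R" "i \<in> I"
      by (auto simp: excision_carrier)
    show "\<exists>y\<in>carrier (excision_ring R I). y \<oplus>\<^bsub>excision_ring R I\<^esub> x = \<zero>\<^bsub>excision_ring R I\<^esub>"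
      using x neg Icarr
      by (intro bexI[of _ "(\<ominus> r, \<ominus> i)"]) (auto simp: excision_simps l_neg)
  qed (auto simp: excision_simps Icarr a_ac)
  show "comm_monoid (excision_ring R I)"
  proof (rule comm_monoidI)
    fix x y z
    assume "x \<in> carrier (excision_ring R I)" "y \<in> carrier (excision_ring R I)"
      "z \<in> carrier (excision_ring R I)"
    then obtain r i s j t k where *: "x = (r, i)" "y = (s, j)" "z = (t, k)"
      "r \<in> carrier R" "s \<in> carrier R" "t \<in> carrier R" "i \<in> carrier R" "j \<in> carrier R" "k \<in> carrier R"
      by (auto simp: excision_carrier Icarr)
    then show "(x \<otimes>\<^bsub>excision_ring R I\<^esub> y) \<otimes>\<^bsub>excision_ring R I\<^esub> z
        = x \<otimes>\<^bsub>excision_ring R I\<^esub> (y \<otimes>\<^bsub>excision_ring R I\<^esub> z)"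
      unfolding * excision_mult prod.inject by (simp add: l_distr r_distr m_ac a_ac)
  qed (auto simp: excision_simps Icarr I_l_closed I_r_closed m_comm a_comm)
  fix x y z
  assume "x \<in> carrier (excision_ring R I)" "y \<in> carrier (excision_ring R I)"
    "z \<in> carrier (excision_ring R I)"
  then obtain r i s j t k where *: "x = (r, i)" "y = (s, j)" "z = (t, k)"
    "r \<in> carrier R" "s \<in> carrier R" "t \<in> carrier R" "i \<in> carrier R" "j \<in> carrier R" "k \<in> carrier R"
    by (auto simp: excision_carrier Icarr)
  then show "(x \<oplus>\<^bsub>excision_ring R I\<^esub> y) \<otimes>\<^bsub>excision_ring R I\<^esub> z
      = (x \<otimes>\<^bsub>excision_ring R I\<^esub> z) \<oplus>\<^bsub>excision_ring R I\<^esub> (y \<otimes>\<^bsub>excision_ring R I\<^esub> z)"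
    unfolding * excision_mult excision_add prod.inject by (simp add: l_distr r_distr m_ac a_ac)
qed

lemma excision_fst_hom:
  assumes "cring R"
  shows "ring_hom_ring (excision_ring R I) R fst"
proof -
  interpret E: cring "excision_ring R I"
    using assms by (rule excision_cring)
  show ?thesis
    by (rule ring_hom_ringI2)
      (auto intro!: ring_hom_memI E.ring_axioms ring_axioms simp: excision_simps)
qed

text \<open>
  Invertibility can be tested on the images \<open>r\<close> and \<open>r \<oplus> i\<close> in \<open>R\<close>, because their inverses differ
  by an element of \<open>I\<close> again.
\<close>

lemma excision_unit:
  assumes "cring R" "r \<in> Units R" "i \<in> I" "r \<oplus> i \<in> Units R"
  shows "(r, i) \<in> Units (excision_ring R I)"
proof -
  interpret cring R by fact
  interpret E: cring "excision_ring R I"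
    using assms(1) by (rule excision_cring)
  obtain u where u: "u \<in> carrier R" "u \<otimes> r = \<one>"
    using assms(2) Units_l_inv_ex by blast
  obtain v where v: "v \<in> carrier R" "v \<otimes> (r \<oplus> i) = \<one>"
    using assms(4) Units_l_inv_ex by blast
  have r: "r \<in> carrier R" and i: "i \<in> carrier R"
    using assms(2,3) Icarr by auto
  \<comment> \<open>The inverse must map to \<open>u\<close> and to \<open>v\<close> under the two homomorphisms, so it is \<open>(u, v - u)\<close>;
      and \<open>v - u\<close> equals \<open>- u v i\<close>, which lies in \<open>I\<close>.\<close>
  define k where "k = \<ominus> (v \<otimes> (u \<otimes> i))"
  have k: "k \<in> I" "k \<in> carrier R"
    using u v i assms(3) unfolding k_def by (simp_all add: I_l_closed)
  have "u \<otimes> i \<oplus> r \<otimes> k \<oplus> k \<otimes> i = u \<otimes> i \<oplus> (r \<oplus> i) \<otimes> k"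
    using u(1) r i k(2) by (simp add: l_distr a_assoc m_comm[of k i])
  also have "(r \<oplus> i) \<otimes> k = \<ominus> (v \<otimes> (r \<oplus> i) \<otimes> (u \<otimes> i))"
    unfolding k_def using u(1) v(1) r i
    by (simp only: r_minus m_assoc m_lcomm a_closed m_closed)
  also have "u \<otimes> i \<oplus> \<dots> = \<zero>"
    using u v i by (simp add: r_neg)
  finally have "(u, k) \<otimes>\<^bsub>excision_ring R I\<^esub> (r, i) = \<one>\<^bsub>excision_ring R I\<^esub>"
    using u(2) by (simp add: excision_simps)
  moreover have carr: "(u, k) \<in> carrier (excision_ring R I)" "(r, i) \<in> carrier (excision_ring R I)"
    using u k r assms(3) by (auto simp: excision_carrier)
  ultimately show ?thesis
    using E.m_comm[OF carr] unfolding Units_def by auto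
qed

end

theorem lemma4p3:
  fixes R :: "('a, 'b) ring_scheme" and m I :: "'a set"
  assumes "local_ring R"
    and "maximalideal m R"
    and "ideal I R"
    and "I \<noteq> carrier R"
  shows "local_ring (excision_ring R I) \<and> maximalideal (m \<times> I) (excision_ring R I)"
proof -
  have R: "cring R"
    using assms(1) by (simp add: local_ring_def)
  interpret m: maximalideal m R by fact
  interpret I: ideal I R by fact
  interpret fst: ring_hom_ring "excision_ring R I" R fst
    using R by (rule I.excision_fst_hom)
  have "m \<times> I = {x \<in> carrier (excision_ring R I). fst x \<in> m}"
    using m.Icarr by (auto simp: I.excision_carrier)
  then have ideal: "ideal (m \<times> I) (excision_ring R I)"
    using fst.ideal_vimage[OF m.ideal_axioms] by simp
  have Im: "I \<subseteq> m"
    using assms by (rule proper_ideal_le_local)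
  show ?thesis
  proof (rule local_of_units_outside)
    show "cring (excision_ring R I)"
      using R by (rule I.excision_cring)
    have "I \<noteq> {}"
      using additive_subgroup.zero_closed[OF I.additive_subgroup_axioms] by blast
    then show "m \<times> I \<noteq> carrier (excision_ring R I)"
      using m.I_notcarr by (simp add: I.excision_carrier times_eq_iff) metis
    fix x assume "x \<in> carrier (excision_ring R I)" "x \<notin> m \<times> I"
    then obtain r i where x: "x = (r, i)" "r \<in> carrier R" "r \<notin> m" "i \<in> I"
      by (auto simp: I.excision_carrier)
    have "r \<oplus>\<^bsub>R\<^esub> i \<notin> m"
    proof
      assume "r \<oplus>\<^bsub>R\<^esub> i \<in> m"
      moreover have "\<ominus>\<^bsub>R\<^esub> i \<in> m"
        using x Im additive_subgroup.a_inv_closed[OF m.additive_subgroup_axioms] by blast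
      ultimately have "(r \<oplus>\<^bsub>R\<^esub> i) \<oplus>\<^bsub>R\<^esub> \<ominus>\<^bsub>R\<^esub> i \<in> m"
        by (rule additive_subgroup.a_closed[OF m.additive_subgroup_axioms])
      with x I.Icarr show False
        by (simp add: m.a_assoc m.r_neg)
    qed
    with x I.Icarr have "r \<in> Units R" "r \<oplus>\<^bsub>R\<^esub> i \<in> Units R"
      using unit_outside_local[OF assms(1,2)] m.a_closed by blast+
    with R x show "x \<in> Units (excision_ring R I)"
      by (simp add: I.excision_unit)
  qed (rule ideal)
qed

end
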